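(* Let $n\ge 2$. An operation $*:(\mathcal{K}^n_s)^2\to\mathcal{K}^n$ is projection covariant if and only if it is continuous and $GL(n)$ covariant (and hence homogeneous of degree $1$).
   Context: $\mathcal{K}^n$ is the class of nonempty compact convex subsets of $\mathbb{R}^n$; $\mathcal{K}^n_s$ is the subclass of sets with $K=-K$. Properties of $*$ (for all $K,L,\dots\in\mathcal{K}^n_s$): projection covariant: $(K*L)|S=(K|S)*(L|S)$ for every linear subspace $S$ of $\mathbb{R}^n$ of dimension $k$, $1\le k\le n-1$, where $X|S$ is the orthogonal projection of $X$ onto $S$ (as a subset of $\mathbb{R}^n$); continuous: $K_m\to K$ and $L_m\to L$ in the Hausdorff metric imply $K_m*L_m\to K*L$ in the Hausdorff metric; $GL(n)$ covariant: $\phi(K*L)=(\phi K)*(\phi L)$ for all $\phi\in GL(n)$; homogeneous of degree $1$: $(rK)*(rL)=r(K*L)$ for all $r\ge 0$. *)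

theory Defs
  imports "HOL-Analysis.Analysis"
begin

definition convex_bodies :: "(real ^ 'n) set set" where
  "convex_bodies = {K. K \<noteq> {} \<and> compact K \<and> convex K}"

definition sym_convex_bodies :: "(real ^ 'n) set set" where
  "sym_convex_bodies = {K \<in> convex_bodies. K = uminus ` K}"

text \<open>The image of \<open>X\<close> under the orthogonal projection onto the subspace \<open>S\<close>, written \<open>X|S\<close> on paper:
  \<open>y\<close> is the projection of \<open>x\<close> iff \<open>y \<in> S\<close> and \<open>x - y\<close> is in the orthogonal complement of \<open>S\<close>.\<close>

definition proj_onto :: "(real ^ 'n) set \<Rightarrow> (real ^ 'n) set \<Rightarrow> (real ^ 'n) set" where
  "proj_onto S X = {y \<in> S. \<exists>x\<in>X. x - y \<in> S\<^sup>\<bottom>}"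

text \<open>Only meaningful for nonempty bounded sets, where both suprema are finite.\<close>

definition hausdorff_dist :: "(real ^ 'n) set \<Rightarrow> (real ^ 'n) set \<Rightarrow> real" where
  "hausdorff_dist K L = max (SUP x\<in>K. infdist x L) (SUP y\<in>L. infdist y K)"

definition hausdorff_conv :: "(nat \<Rightarrow> (real ^ 'n) set) \<Rightarrow> (real ^ 'n) set \<Rightarrow> bool" where
  "hausdorff_conv X K \<longleftrightarrow> (\<lambda>m. hausdorff_dist (X m) K) \<longlonglongrightarrow> 0"

text \<open>An operation is a function on all pairs of sets; the properties below only constrain its
  values on pairs of origin-symmetric convex bodies.\<close>

definition projection_covariant ::
    "((real ^ 'n) set \<Rightarrow> (real ^ 'n) set \<Rightarrow> (real ^ 'n) set) \<Rightarrow> bool" where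
  "projection_covariant star \<longleftrightarrow>
     (\<forall>K\<in>sym_convex_bodies. \<forall>L\<in>sym_convex_bodies. \<forall>S.
        subspace S \<longrightarrow> 1 \<le> dim S \<longrightarrow> dim S \<le> CARD('n) - 1 \<longrightarrow>
        proj_onto S (star K L) = star (proj_onto S K) (proj_onto S L))"

definition hausdorff_continuous ::
    "((real ^ 'n) set \<Rightarrow> (real ^ 'n) set \<Rightarrow> (real ^ 'n) set) \<Rightarrow> bool" where
  "hausdorff_continuous star \<longleftrightarrow>
     (\<forall>Ks Ls K L. (\<forall>m. Ks m \<in> sym_convex_bodies) \<longrightarrow> (\<forall>m. Ls m \<in> sym_convex_bodies) \<longrightarrow>
        K \<in> sym_convex_bodies \<longrightarrow> L \<in> sym_convex_bodies \<longrightarrow>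
        hausdorff_conv Ks K \<longrightarrow> hausdorff_conv Ls L \<longrightarrow>
        hausdorff_conv (\<lambda>m. star (Ks m) (Ls m)) (star K L))"

definition GL_covariant ::
    "((real ^ 'n) set \<Rightarrow> (real ^ 'n) set \<Rightarrow> (real ^ 'n) set) \<Rightarrow> bool" where
  "GL_covariant star \<longleftrightarrow>
     (\<forall>K\<in>sym_convex_bodies. \<forall>L\<in>sym_convex_bodies. \<forall>\<phi>. linear \<phi> \<longrightarrow> bij \<phi> \<longrightarrow>
        \<phi> ` star K L = star (\<phi> ` K) (\<phi> ` L))"

definition homogeneous_deg_1 ::
    "((real ^ 'n) set \<Rightarrow> (real ^ 'n) set \<Rightarrow> (real ^ 'n) set) \<Rightarrow> bool" where
  "homogeneous_deg_1 star \<longleftrightarrow>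
     (\<forall>K\<in>sym_convex_bodies. \<forall>L\<in>sym_convex_bodies. \<forall>r\<ge>0.
        star ((\<lambda>x. r *\<^sub>R x) ` K) ((\<lambda>x. r *\<^sub>R x) ` L) = (\<lambda>x. r *\<^sub>R x) ` star K L)"

end

theory Submission
  imports Defs
begin

text \<open>Write \<open>h K\<close> for the support function of \<open>K\<close>. If \<open>*\<close> is projection covariant, projecting onto
  the line through a unit vector \<open>u\<close> gives \<open>h (K * L) u = F u (h K u) (h L u)\<close>, where \<open>F u s t\<close> is the
  value of \<open>h ([-su, su] * [-tu, tu])\<close> at \<open>u\<close>. Projecting segments from one line to another shows that
  \<open>F u\<close> does not depend on \<open>u\<close> and is homogeneous of degree 1. Evaluating it with the segments
  \<open>[-e, e]\<close> and \<open>[-e', e']\<close> for orthonormal \<open>e, e'\<close> yields \<open>F s t = h M (s e + t e')\<close> with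
  \<open>M = [-e, e] * [-e', e']\<close>, which is Lipschitz; so \<open>h (K * L) x = F (h K x) (h L x)\<close>, whence
  continuity and \<open>GL(n)\<close> covariance. Conversely, the orthogonal projection \<open>p\<close> onto a subspace is the
  limit of the invertible maps \<open>p + \<epsilon> (I - p)\<close>; the subspace \<open>{0}\<close> gives homogeneity for the
  factor 0.\<close>

section \<open>Support functions of compact sets\<close>

definition support_fun :: "'a::real_inner set \<Rightarrow> 'a \<Rightarrow> real" where
  "support_fun K x = (SUP y\<in>K. y \<bullet> x)"

lemma support_fun_eqI:
  assumes "\<And>y. y \<in> K \<Longrightarrow> y \<bullet> x \<le> c" and "y \<in> K" and "y \<bullet> x = c"
  shows "support_fun K x = c"
  unfolding support_fun_def by (rule cSup_eq_maximum) (use assms in auto)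

lemma support_fun_attained:
  assumes "compact K" and "K \<noteq> {}"
  obtains y where "y \<in> K" and "support_fun K x = y \<bullet> x"
proof -
  have "continuous_on K (\<lambda>y. y \<bullet> x)"
    by (intro continuous_intros)
  then obtain y where "y \<in> K" "\<And>z. z \<in> K \<Longrightarrow> z \<bullet> x \<le> y \<bullet> x"
    using continuous_attains_sup[OF assms] by blast
  then show thesis
    by (metis that support_fun_eqI)
qed

lemma inner_le_support_fun:
  assumes "compact K" and "y \<in> K"
  shows "y \<bullet> x \<le> support_fun K x"
proof -
  have "compact ((\<lambda>y. y \<bullet> x) ` K)"
    by (intro compact_continuous_image continuous_intros assms(1))
  then show ?thesis
    unfolding support_fun_def
    by (intro cSUP_upper assms(2) bounded_imp_bdd_above compact_imp_bounded)
qed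

lemma support_fun_le:
  assumes "compact K" and "K \<noteq> {}" and "\<And>y. y \<in> K \<Longrightarrow> y \<bullet> x \<le> c"
  shows "support_fun K x \<le> c"
  using support_fun_attained[OF assms(1,2)] assms(3) by metis

lemma support_fun_0:
  assumes "K \<noteq> {}"
  shows "support_fun K 0 = 0"
  using assms by (auto intro: support_fun_eqI)

lemma support_fun_scaleR:
  assumes "compact K" and "K \<noteq> {}" and "c \<ge> 0"
  shows "support_fun K (c *\<^sub>R x) = c * support_fun K x"
proof -
  obtain y where y: "y \<in> K" "support_fun K x = y \<bullet> x"
    using support_fun_attained[OF assms(1,2)] .
  have "z \<bullet> x \<le> y \<bullet> x" if "z \<in> K" for z
    using inner_le_support_fun[OF assms(1) that, of x] y(2) by simp
  then show ?thesis
    by (intro support_fun_eqI[where y = y]) (simp_all add: y assms(3) mult_left_mono)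
qed

text \<open>By Cauchy-Schwarz each functional \<open>y \<bullet> x\<close> with \<open>y\<close> in
  \<open>K\<close> is \<open>C\<close>-Lipschitz in \<open>x\<close>, and the supremum inherits the
  constant. Applied to the body \<open>M\<close> of \<open>support_fun_star_eq\<close>, this is the
  source of continuity.\<close>

lemma support_fun_diff_le:
  assumes "compact K" and "K \<noteq> {}" and "\<And>y. y \<in> K \<Longrightarrow> norm y \<le> C"
  shows "\<bar>support_fun K x - support_fun K z\<bar> \<le> C * norm (x - z)"
proof -
  have *: "support_fun K x \<le> support_fun K z + C * norm (x - z)" for x z
  proof (rule support_fun_le[OF assms(1,2)])
    fix y assume y: "y \<in> K"
    have "y \<bullet> (x - z) \<le> norm y * norm (x - z)"
      by (rule norm_cauchy_schwarz)
    also have "\<dots> \<le> C * norm (x - z)"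
      by (intro mult_right_mono assms(3) y) simp
    finally show "y \<bullet> x \<le> support_fun K z + C * norm (x - z)"
      using inner_le_support_fun[OF assms(1) y, of z] by (simp add: inner_diff_right)
  qed
  show ?thesis
    using *[of x z] *[of z x] by (simp add: norm_minus_commute abs_le_iff)
qed

section \<open>Linear images and origin symmetry\<close>

lemma convex_body_linear_image:
  assumes "linear f" and "K \<in> convex_bodies"
  shows "f ` K \<in> convex_bodies"
  using assms
  by (auto simp: convex_bodies_def convex_linear_image linear_continuous_on linear_linear
      intro!: compact_continuous_image)

lemma sym_convex_body_linear_image:
  fixes f :: "real ^ 'n \<Rightarrow> real ^ 'n"
  assumes "linear f" and "K \<in> sym_convex_bodies"
  shows "f ` K \<in> sym_convex_bodies"
proof -
  have "uminus ` K = K"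
    using assms(2) by (auto simp: sym_convex_bodies_def)
  then have "uminus ` f ` K = f ` K"
    using linear_neg[OF assms(1)] by (metis (no_types, lifting) image_cong image_image)
  then show ?thesis
    using assms convex_body_linear_image by (auto simp: sym_convex_bodies_def)
qed

lemma support_fun_uminus:
  assumes "K \<in> sym_convex_bodies"
  shows "support_fun K (- x) = support_fun K x"
proof -
  have "support_fun K x = support_fun (uminus ` K) x"
    using assms by (simp add: sym_convex_bodies_def)
  also have "\<dots> = support_fun K (- x)"
    by (simp add: support_fun_def image_image)
  finally show ?thesis ..
qed

lemma support_fun_nonneg:
  assumes "K \<in> sym_convex_bodies"
  shows "support_fun K x \<ge> 0"
proof -
  obtain y where y: "y \<in> K" and "compact K"
    using assms by (auto simp: sym_convex_bodies_def convex_bodies_def)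
  then have "y \<bullet> x \<le> support_fun K x" "y \<bullet> - x \<le> support_fun K (- x)"
    by (simp_all only: inner_le_support_fun)
  then show ?thesis
    using support_fun_uminus[OF assms, of x] by simp
qed

section \<open>Hausdorff distance in terms of support functions\<close>

lemma infdist_le_support_fun_diff:
  fixes K L :: "(real ^ 'n) set"
  assumes "K \<in> convex_bodies" and "L \<in> convex_bodies" and "e \<ge> 0"
    and le: "\<And>u. norm u = 1 \<Longrightarrow> support_fun K u \<le> support_fun L u + e"
    and x: "x \<in> K"
  shows "infdist x L \<le> e"
proof -
  have L: "closed L" "L \<noteq> {}" "convex L" "compact K"
    using assms(1,2) by (auto simp: convex_bodies_def compact_imp_closed)
  define y where "y = closest_point L x"
  have y: "y \<in> L"
    unfolding y_def by (rule closest_point_in_set[OF L(1,2)])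
  have "dist x y \<le> e"
  proof (cases "x = y")
    case False
    \<comment> \<open>The unit direction from the closest point \<open>y\<close> to
      \<open>x\<close>. The hyperplane through \<open>y\<close> normal to \<open>u\<close> supports
      \<open>L\<close>, so the distance from \<open>x\<close> to \<open>L\<close> is read off from
      the two support functions at \<open>u\<close>.\<close>
    define u where "u = (1 / norm (x - y)) *\<^sub>R (x - y)"
    have pos: "norm (x - y) > 0"
      using False by simp
    have u: "norm u = 1"
      using pos by (simp add: u_def)
    have "support_fun L u = y \<bullet> u"
    proof (rule support_fun_eqI[OF _ y refl])
      fix z assume "z \<in> L"
      then have "(x - y) \<bullet> (z - y) \<le> 0"
        unfolding y_def by (intro closest_point_dot L)
      then have "u \<bullet> (z - y) \<le> 0"
        by (simp add: u_def divide_le_0_iff)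
      then show "z \<bullet> u \<le> y \<bullet> u"
        by (simp add: inner_diff_right inner_commute)
    qed
    moreover have "x \<bullet> u \<le> support_fun K u"
      by (rule inner_le_support_fun[OF L(4) x])
    ultimately have "(x - y) \<bullet> u \<le> e"
      using le[OF u] by (simp add: inner_diff_left)
    moreover have "(x - y) \<bullet> u = norm (x - y)"
      using pos by (simp add: u_def power2_norm_eq_inner[symmetric] power2_eq_square)
    ultimately show ?thesis
      by (simp add: dist_norm)
  qed (use assms(3) in simp)
  then show ?thesis
    by (rule infdist_le2[OF y])
qed

text \<open>The distance bound with \<open>e = 0\<close> puts every point of either body at distance
  0 from the other, which is closed.\<close>

lemma convex_body_eqI:
  fixes K L :: "(real ^ 'n) set"
  assumes "K \<in> convex_bodies" and "L \<in> convex_bodies"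
    and "\<And>x. support_fun K x = support_fun L x"
  shows "K = L"
proof -
  have "K \<subseteq> L" if "K \<in> convex_bodies" "L \<in> convex_bodies" "\<And>x. support_fun K x = support_fun L x"
    for K L :: "(real ^ 'n) set"
  proof
    fix x assume "x \<in> K"
    then have "infdist x L \<le> 0"
      using infdist_le_support_fun_diff[of K L 0 x] that by simp
    moreover have "closed L" "L \<noteq> {}"
      using that(2) by (auto simp: convex_bodies_def compact_imp_closed)
    ultimately show "x \<in> L"
      using in_closed_iff_infdist_zero infdist_nonneg[of x L] by (metis order_antisym)
  qed
  from this[of K L] this[of L K] show ?thesis
    using assms by auto
qed

lemma hausdorff_dist_commute: "hausdorff_dist K L = hausdorff_dist L K"
  by (simp add: hausdorff_dist_def max.commute)

lemma hausdorff_dist_le: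
  assumes "K \<noteq> {}" and "L \<noteq> {}"
    and "\<And>x. x \<in> K \<Longrightarrow> infdist x L \<le> e" and "\<And>y. y \<in> L \<Longrightarrow> infdist y K \<le> e"
  shows "hausdorff_dist K L \<le> e"
  unfolding hausdorff_dist_def using assms by (auto intro: cSUP_least)

lemma infdist_le_hausdorff_dist:
  assumes "compact K" and "x \<in> K"
  shows "infdist x L \<le> hausdorff_dist K L"
proof -
  have "compact ((\<lambda>x. infdist x L) ` K)"
    by (intro compact_continuous_image continuous_intros assms(1))
  then have "infdist x L \<le> (SUP x\<in>K. infdist x L)"
    by (intro cSUP_upper assms(2) bounded_imp_bdd_above compact_imp_bounded)
  then show ?thesis
    by (simp add: hausdorff_dist_def)
qed

lemma hausdorff_dist_nonneg:
  assumes "compact K" and "K \<noteq> {}"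
  shows "hausdorff_dist K L \<ge> 0"
  using assms infdist_le_hausdorff_dist[of K _ L] infdist_nonneg[of _ L]
  by (meson all_not_in_conv order_trans)

text \<open>Replace a maximiser in one body by its nearest point in the other: a unit functional
  changes by at most their distance. With the converse
  \<open>hausdorff_dist_le_support_fun_diff\<close>, Hausdorff distance becomes uniform distance of
  support functions on the unit sphere.\<close>

lemma support_fun_diff_le_hausdorff_dist:
  fixes K L :: "(real ^ 'n) set"
  assumes "K \<in> convex_bodies" and "L \<in> convex_bodies" and "norm u = 1"
  shows "\<bar>support_fun K u - support_fun L u\<bar> \<le> hausdorff_dist K L"
proof -
  have *: "support_fun K u \<le> support_fun L u + hausdorff_dist K L"
    if "K \<in> convex_bodies" "L \<in> convex_bodies" for K L :: "(real ^ 'n) set"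
  proof -
    have KL: "compact K" "K \<noteq> {}" "compact L" "L \<noteq> {}"
      using that by (auto simp: convex_bodies_def)
    obtain x where x: "x \<in> K" "support_fun K u = x \<bullet> u"
      using support_fun_attained[OF KL(1,2)] .
    obtain y where y: "y \<in> L" "infdist x L = dist x y"
      using infdist_attains_inf[OF compact_imp_closed[OF KL(3)] KL(4)] .
    have "(x - y) \<bullet> u \<le> norm (x - y)"
      using norm_cauchy_schwarz[of "x - y" u] assms(3) by simp
    also have "\<dots> \<le> hausdorff_dist K L"
      using infdist_le_hausdorff_dist[OF KL(1) x(1), of L] y(2) by (simp add: dist_norm)
    finally show ?thesis
      using inner_le_support_fun[OF KL(3) y(1), of u] x(2) by (simp add: inner_diff_left)
  qed
  show ?thesis
    using *[OF assms(1,2)] *[OF assms(2,1)] by (simp add: hausdorff_dist_commute abs_le_iff)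
qed

lemma hausdorff_dist_le_support_fun_diff:
  fixes K L :: "(real ^ 'n) set"
  assumes "K \<in> convex_bodies" and "L \<in> convex_bodies" and "e \<ge> 0"
    and le: "\<And>u. norm u = 1 \<Longrightarrow> \<bar>support_fun K u - support_fun L u\<bar> \<le> e"
  shows "hausdorff_dist K L \<le> e"
proof (rule hausdorff_dist_le)
  show "K \<noteq> {}" "L \<noteq> {}"
    using assms(1,2) by (auto simp: convex_bodies_def)
  show "infdist x L \<le> e" if "x \<in> K" for x
    using infdist_le_support_fun_diff[OF assms(1-3) _ that] le by (smt (verit))
  show "infdist x K \<le> e" if "x \<in> L" for x
    using infdist_le_support_fun_diff[OF assms(2,1,3) _ that] le by (smt (verit))
qed

text \<open>At each unit vector the support functions of \<open>X m\<close> converge to those of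
  both limits, so these agree there; positive homogeneity extends the agreement to all
  vectors.\<close>

lemma hausdorff_conv_unique:
  fixes K L :: "(real ^ 'n) set"
  assumes "\<And>m. X m \<in> convex_bodies" and "K \<in> convex_bodies" and "L \<in> convex_bodies"
    and "hausdorff_conv X K" and "hausdorff_conv X L"
  shows "K = L"
proof (rule convex_body_eqI[OF assms(2,3)])
  fix x :: "real ^ 'n"
  have lim: "(\<lambda>m. support_fun (X m) u) \<longlonglongrightarrow> support_fun A u"
    if "A \<in> convex_bodies" "hausdorff_conv X A" "norm u = 1" for A u
  proof (rule LIM_zero_cancel, rule Lim_null_comparison)
    show "(\<lambda>m. hausdorff_dist (X m) A) \<longlonglongrightarrow> 0"
      using that(2) by (simp add: hausdorff_conv_def)
  qed (simp add: support_fun_diff_le_hausdorff_dist that assms(1))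
  have unit: "support_fun K u = support_fun L u" if "norm u = 1" for u
    using lim[OF assms(2,4) that] lim[OF assms(3,5) that] by (rule LIMSEQ_unique)
  show "support_fun K x = support_fun L x"
  proof (cases "x = 0")
    case False
    have *: "support_fun A x = norm x * support_fun A (sgn x)" if "A \<in> convex_bodies" for A
      using support_fun_scaleR[of A "norm x" "sgn x"] that False
      by (simp add: convex_bodies_def sgn_div_norm)
    show ?thesis
      using unit[of "sgn x"] False assms(2,3) by (simp add: * norm_sgn)
  qed (use assms(2,3) in \<open>simp add: support_fun_0 convex_bodies_def\<close>)
qed

section \<open>Orthogonal projections as linear maps\<close>

lemma proj_onto_eq_image:
  assumes "subspace S" and P: "\<And>x. p x \<in> S" "\<And>x. x - p x \<in> S\<^sup>\<bottom>"
  shows "proj_onto S X = p ` X"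
proof -
  have "y = p x" if "y \<in> S" "x - y \<in> S\<^sup>\<bottom>" for x y
  proof -
    \<comment> \<open>Two candidates for the projection of \<open>x\<close> differ by a vector lying
      both in \<open>S\<close> and in its orthogonal complement, hence orthogonal to itself.\<close>
    have "(x - p x) - (x - y) \<in> S\<^sup>\<bottom>"
      by (intro subspace_diff subspace_orthogonal_comp P that)
    moreover have "y - p x \<in> S"
      by (intro subspace_diff assms(1) P that)
    ultimately have "orthogonal (y - p x) (y - p x)"
      by (simp add: orthogonal_comp_def)
    then show ?thesis
      by (simp add: orthogonal_self)
  qed
  then show ?thesis
    using P by (fastforce simp: proj_onto_def)
qed

lemma orthogonal_projection_exists:
  fixes S :: "'a::euclidean_space set"
  assumes "subspace S"
  obtains p where "linear p" and "\<And>x. p x \<in> S" and "\<And>x. x - p x \<in> S\<^sup>\<bottom>"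
proof -
  obtain B where B: "B \<subseteq> S" "pairwise orthogonal B" "\<And>x. x \<in> B \<Longrightarrow> norm x = 1"
    "independent B" "span B = S"
    using orthonormal_basis_subspace[OF assms] by metis
  have "finite B"
    using B(4) by (rule independent_imp_finite)
  define p where "p x = (\<Sum>b\<in>B. (x \<bullet> b) *\<^sub>R b)" for x
  have "linear p"
    unfolding p_def
    by (intro linearI) (simp_all add: inner_add_left scaleR_add_left sum.distrib scaleR_sum_right)
  moreover have "p x \<in> S" for x
    unfolding p_def using B(1) by (intro subspace_sum subspace_scale assms) auto
  moreover have "x - p x \<in> S\<^sup>\<bottom>" for x
  proof -
    have "(x - p x) \<bullet> b = 0" if b: "b \<in> B" for b
    proof -
      have "p x \<bullet> b = (\<Sum>c\<in>B. if c = b then x \<bullet> b else 0)"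
        unfolding p_def inner_sum_left
      proof (intro sum.cong refl)
        fix c assume "c \<in> B"
        then show "(x \<bullet> c) *\<^sub>R c \<bullet> b = (if c = b then x \<bullet> b else 0)"
          using b B(2) B(3)[OF b] by (auto simp: pairwise_def orthogonal_def norm_eq_1)
      qed
      then show ?thesis
        using \<open>finite B\<close> b by (simp add: inner_diff_left)
    qed
    then have "orthogonal (x - p x) s" if "s \<in> span B" for s
      by (intro orthogonal_to_span[OF that]) (simp add: orthogonal_def)
    then show ?thesis
      unfolding B(5) by (simp add: orthogonal_comp_def orthogonal_commute)
  qed
  ultimately show thesis
    by (rule that)
qed

lemma proj_onto_span:
  assumes "norm u = 1"
  shows "proj_onto (span {u}) X = (\<lambda>x. (x \<bullet> u) *\<^sub>R u) ` X"
proof (rule proj_onto_eq_image)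
  fix x
  show "(x \<bullet> u) *\<^sub>R u \<in> span {u}"
    by (simp add: span_base span_mul)
  have "orthogonal y (x - (x \<bullet> u) *\<^sub>R u)" if y: "y \<in> span {u}" for y
    using y assms
    by (auto simp: span_singleton orthogonal_def inner_diff_right inner_commute norm_eq_1)
  then show "x - (x \<bullet> u) *\<^sub>R u \<in> (span {u})\<^sup>\<bottom>"
    by (simp add: orthogonal_comp_def)
qed simp

section \<open>From continuity and GL covariance to projection covariance\<close>

lemma hausdorff_conv_shrink_to_projection:
  fixes p :: "real ^ 'n \<Rightarrow> real ^ 'n"
  assumes "K \<in> convex_bodies" and "linear p"
  shows "hausdorff_conv (\<lambda>m. (\<lambda>x. p x + (1 / real (Suc m)) *\<^sub>R (x - p x)) ` K) (p ` K)"
proof -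
  have K: "compact K" "K \<noteq> {}"
    using assms(1) by (auto simp: convex_bodies_def)
  have p: "continuous_on K p"
    using assms(2) by (simp add: linear_continuous_on linear_linear)
  \<comment> \<open>Compactness bounds the vectors \<open>x - p x\<close> by one constant
    \<open>C\<close>, so the perturbed map stays within \<open>C / Suc m\<close> of \<open>p\<close>
    uniformly on \<open>K\<close>.\<close>
  have "compact ((\<lambda>x. x - p x) ` K)"
    by (intro compact_continuous_image continuous_intros p K(1))
  then have "bounded ((\<lambda>x. x - p x) ` K)"
    by (rule compact_imp_bounded)
  then obtain C where "\<forall>y\<in>(\<lambda>x. x - p x) ` K. norm y \<le> C"
    unfolding bounded_iff ..
  then have C: "\<And>x. x \<in> K \<Longrightarrow> norm (x - p x) \<le> C"
    by simp
  define q where "q m x = p x + (1 / real (Suc m)) *\<^sub>R (x - p x)" for m x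
  have d: "dist (q m x) (p x) \<le> C * (1 / real (Suc m))" if "x \<in> K" for m x
    using C[OF that] by (simp add: q_def dist_norm divide_right_mono)
  have cq: "compact (q m ` K)" for m
    unfolding q_def
    by (intro compact_continuous_image continuous_intros p K(1))
  have "hausdorff_dist (q m ` K) (p ` K) \<le> C * (1 / real (Suc m))" for m
  proof (rule hausdorff_dist_le)
    show "infdist y (p ` K) \<le> C * (1 / real (Suc m))" if "y \<in> q m ` K" for y
      using that d by (auto intro: infdist_le2)
    show "infdist y (q m ` K) \<le> C * (1 / real (Suc m))" if "y \<in> p ` K" for y
    proof -
      from that obtain x where x: "x \<in> K" "y = p x"
        by blast
      show ?thesis
        by (rule infdist_le2[of "q m x"]) (use x d[of x m] in \<open>auto simp: dist_commute\<close>)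
    qed
  qed (use K in auto)
  moreover have "0 \<le> hausdorff_dist (q m ` K) (p ` K)" for m
    by (rule hausdorff_dist_nonneg[OF cq]) (use K in auto)
  ultimately have le: "norm (hausdorff_dist (q m ` K) (p ` K)) \<le> C * (1 / real (Suc m))" for m
    by simp
  have lim: "(\<lambda>m. C * (1 / real (Suc m))) \<longlonglongrightarrow> 0"
    by (rule tendsto_mult_right_zero) (use LIMSEQ_inverse_real_of_nat in \<open>simp add: inverse_eq_divide\<close>)
  have "(\<lambda>m. hausdorff_dist (q m ` K) (p ` K)) \<longlonglongrightarrow> 0"
    by (rule Lim_null_comparison[OF always_eventually lim]) (blast intro: le)
  then show ?thesis
    by (simp add: hausdorff_conv_def q_def[abs_def])
qed

lemma continuous_GL_covariant_image:
  fixes p :: "real ^ 'n \<Rightarrow> real ^ 'n"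
  assumes star: "\<And>K L. K \<in> sym_convex_bodies \<Longrightarrow> L \<in> sym_convex_bodies \<Longrightarrow> star K L \<in> convex_bodies"
    and cont: "hausdorff_continuous star" and GL: "GL_covariant star"
    and S: "subspace S" "linear p" "\<And>x. p x \<in> S" "\<And>x. x - p x \<in> S\<^sup>\<bottom>"
    and K: "K \<in> sym_convex_bodies" and L: "L \<in> sym_convex_bodies"
  shows "p ` star K L = star (p ` K) (p ` L)"
proof -
  define q where "q m x = p x + (1 / real (Suc m)) *\<^sub>R (x - p x)" for m x
  have lin: "linear (q m)" for m
    unfolding q_def
    by (intro linear_compose_add linear_compose_scale_right linear_compose_sub S(2) linear_ident)
  \<comment> \<open>Since \<open>p x\<close> and \<open>x - p x\<close> are orthogonal, pairing
    \<open>q m x = 0\<close> with each of them forces both to vanish, and \<open>x\<close> is their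
    sum.\<close>
  have "x = 0" if "q m x = 0" for m x
  proof -
    have "orthogonal (p x) (x - p x)"
      using S(3,4) by (auto simp: orthogonal_comp_def)
    then have o: "p x \<bullet> (x - p x) = 0"
      by (simp add: orthogonal_def)
    then have "(x - p x) \<bullet> p x = 0"
      by (metis inner_commute)
    then have "q m x \<bullet> p x = p x \<bullet> p x"
      by (simp add: q_def inner_add_left)
    moreover have "q m x \<bullet> (x - p x) = (1 / real (Suc m)) * ((x - p x) \<bullet> (x - p x))"
      using o by (simp add: q_def inner_add_left)
    ultimately have "p x = 0" "x - p x = 0"
      using that by auto
    then show "x = 0"
      by simp
  qed
  then have "inj (q m)" for m
    using lin by (auto simp: linear_injective_0)
  then have bij: "bij (q m)" for m
    by (simp add: bij_def linear_injective_imp_surjective[OF lin])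
  have eq: "q m ` star K L = star (q m ` K) (q m ` L)" for m
    using GL K L lin bij by (auto simp: GL_covariant_def)
  have conv: "hausdorff_conv (\<lambda>m. q m ` A) (p ` A)" if "A \<in> convex_bodies" for A
    unfolding q_def by (rule hausdorff_conv_shrink_to_projection[OF that S(2)])
  have sym: "A \<in> convex_bodies" if "A \<in> sym_convex_bodies" for A :: "(real ^ 'n) set"
    using that by (simp add: sym_convex_bodies_def)
  have "hausdorff_conv (\<lambda>m. star (q m ` K) (q m ` L)) (star (p ` K) (p ` L))"
    by (rule cont[unfolded hausdorff_continuous_def, rule_format,
          of "\<lambda>m. q m ` K" "\<lambda>m. q m ` L"])
       (simp_all add: sym_convex_body_linear_image lin S(2) K L conv sym)
  then have "hausdorff_conv (\<lambda>m. q m ` star K L) (star (p ` K) (p ` L))"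
    by (simp add: eq)
  then show ?thesis
    by (intro hausdorff_conv_unique[OF _ _ _ conv])
       (simp_all add: star K L S(2) lin convex_body_linear_image sym_convex_body_linear_image)
qed

lemma projection_covariant_if_continuous_GL_covariant:
  fixes star :: "(real ^ 'n) set \<Rightarrow> (real ^ 'n) set \<Rightarrow> (real ^ 'n) set"
  assumes star: "\<And>K L. K \<in> sym_convex_bodies \<Longrightarrow> L \<in> sym_convex_bodies \<Longrightarrow> star K L \<in> convex_bodies"
    and cont: "hausdorff_continuous star" and GL: "GL_covariant star"
  shows "projection_covariant star"
  unfolding projection_covariant_def
proof (intro ballI allI impI)
  fix K L S :: "(real ^ 'n) set"
  assume KL: "K \<in> sym_convex_bodies" "L \<in> sym_convex_bodies" and S: "subspace S"
  obtain p where p: "linear p" "\<And>x. p x \<in> S" "\<And>x. x - p x \<in> S\<^sup>\<bottom>"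
    using orthogonal_projection_exists[OF S] by blast
  show "proj_onto S (star K L) = star (proj_onto S K) (proj_onto S L)"
    unfolding proj_onto_eq_image[OF S p(2,3)]
    by (intro continuous_GL_covariant_image[where star = star, OF _ cont GL S p KL] star)
qed

lemma homogeneous_if_continuous_GL_covariant:
  fixes star :: "(real ^ 'n) set \<Rightarrow> (real ^ 'n) set \<Rightarrow> (real ^ 'n) set"
  assumes star: "\<And>K L. K \<in> sym_convex_bodies \<Longrightarrow> L \<in> sym_convex_bodies \<Longrightarrow> star K L \<in> convex_bodies"
    and cont: "hausdorff_continuous star" and GL: "GL_covariant star"
  shows "homogeneous_deg_1 star"
  unfolding homogeneous_deg_1_def
proof (intro ballI allI impI)
  fix K L :: "(real ^ 'n) set" and r :: real
  assume KL: "K \<in> sym_convex_bodies" "L \<in> sym_convex_bodies" and "r \<ge> 0"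
  show "star ((\<lambda>x. r *\<^sub>R x) ` K) ((\<lambda>x. r *\<^sub>R x) ` L) = (\<lambda>x. r *\<^sub>R x) ` star K L"
  proof (cases "r = 0")
    case True
    \<comment> \<open>Scaling by 0 is not invertible, but it is the orthogonal projection onto
      \<open>{0}\<close>.\<close>
    define p where "p = (\<lambda>x :: real ^ 'n. r *\<^sub>R x)"
    have p0: "p x = 0" for x
      by (simp add: p_def True)
    have "linear p"
      by (simp add: linear_iff p0)
    moreover have "p x \<in> {0}" "x - p x \<in> {0}\<^sup>\<bottom>" for x
      by (simp_all add: p0 orthogonal_comp_def orthogonal_def)
    ultimately have "p ` star K L = star (p ` K) (p ` L)"
      by (intro continuous_GL_covariant_image[where star = star, OF _ cont GL subspace_single_0 _ _ _ KL] star)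
    then show ?thesis
      by (simp only: p_def)
  next
    case False
    then have bij: "bij (\<lambda>x::real ^ 'n. r *\<^sub>R x)"
      by (intro bij_betw_byWitness[where f' = "\<lambda>x. (1 / r) *\<^sub>R x"]) auto
    have lin: "linear (\<lambda>x::real ^ 'n. r *\<^sub>R x)"
      by (simp add: linear_scale_self)
    show ?thesis
      by (rule GL[unfolded GL_covariant_def, rule_format, OF KL lin bij, symmetric])
  qed
qed

section \<open>Symmetric segments and orthogonal unit vectors\<close>

abbreviation symmetric_segment :: "'a::real_vector \<Rightarrow> 'a set" where
  "symmetric_segment v \<equiv> closed_segment (- v) v"

lemma symmetric_segment_body: "symmetric_segment v \<in> sym_convex_bodies"
proof -
  have "uminus ` closed_segment (- v) v = closed_segment (- v) v"
    using closed_segment_linear_image[of uminus "- v" v]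
    by (simp add: closed_segment_commute linear_uminus)
  then show ?thesis
    by (auto simp: sym_convex_bodies_def convex_bodies_def)
qed

lemma support_fun_symmetric_segment: "support_fun (symmetric_segment v) x = \<bar>v \<bullet> x\<bar>"
proof (rule support_fun_eqI)
  show "(if v \<bullet> x \<ge> 0 then v else - v) \<in> symmetric_segment v"
    by (cases "v \<bullet> x \<ge> 0") (simp_all only: if_True if_False ends_in_segment)
  show "(if v \<bullet> x \<ge> 0 then v else - v) \<bullet> x = \<bar>v \<bullet> x\<bar>"
    by (simp add: abs_if)
  fix y assume "y \<in> symmetric_segment v"
  then have "\<exists>u. 0 \<le> u \<and> u \<le> 1 \<and> y = (1 - u) *\<^sub>R (- v) + u *\<^sub>R v"
    by (simp only: in_segment)
  then obtain u where u: "0 \<le> u" "u \<le> 1" and y: "y = (1 - u) *\<^sub>R (- v) + u *\<^sub>R v"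
    by (elim exE conjE)
  \<comment> \<open>The point with parameter \<open>u\<close> is \<open>(2 * u - 1)\<close> times
    \<open>v\<close>, and this factor has absolute value at most 1.\<close>
  have "y \<bullet> x = (2 * u - 1) * (v \<bullet> x)"
    unfolding y by (simp add: inner_diff_left left_diff_distrib)
  also have "\<dots> \<le> \<bar>(2 * u - 1) * (v \<bullet> x)\<bar>"
    by (rule abs_ge_self)
  also have "\<dots> = \<bar>2 * u - 1\<bar> * \<bar>v \<bullet> x\<bar>"
    by (rule abs_mult)
  also have "\<dots> \<le> 1 * \<bar>v \<bullet> x\<bar>"
    using u by (intro mult_right_mono) linarith+
  finally show "y \<bullet> x \<le> \<bar>v \<bullet> x\<bar>"
    by simp
qed

lemma orthogonal_unit_vector_exists:
  fixes u :: "real ^ 'n"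
  assumes "CARD('n) \<ge> 2"
  obtains w where "norm w = 1" and "u \<bullet> w = 0"
proof -
  have "2 \<le> DIM(real ^ 'n)"
    using assms by simp
  then obtain w where w: "w \<noteq> 0" "orthogonal u w"
    by (rule orthogonal_to_vector_exists)
  show thesis
    by (rule that[of "sgn w"]) (use w in \<open>simp_all add: norm_sgn sgn_div_norm orthogonal_def\<close>)
qed

section \<open>From projection covariance to continuity and GL covariance\<close>

locale projection_covariant_operation =
  fixes star :: "(real ^ 'n) set \<Rightarrow> (real ^ 'n) set \<Rightarrow> (real ^ 'n) set"
  assumes dim_ge_2: "CARD('n) \<ge> 2"
    and star_body: "\<And>K L. K \<in> sym_convex_bodies \<Longrightarrow> L \<in> sym_convex_bodies \<Longrightarrow> star K L \<in> convex_bodies"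
    and proj_cov: "projection_covariant star"
begin

text \<open>Reading only the end of the resulting segment in direction \<open>u\<close> is
  deliberate: \<open>star K L\<close> is not assumed symmetric, and the opposite end is recorded by
  the value at \<open>- u\<close>.\<close>

definition line_fun :: "real ^ 'n \<Rightarrow> real \<Rightarrow> real \<Rightarrow> real" where
  "line_fun u s t = support_fun (star (symmetric_segment (s *\<^sub>R u)) (symmetric_segment (t *\<^sub>R u))) u"

text \<open>Lines are admissible subspaces because \<open>CARD('n) \<ge> 2\<close> gives
  \<open>1 \<le> CARD('n) - 1\<close>.\<close>

lemma proj_line:
  assumes "norm u = 1" and "K \<in> sym_convex_bodies" and "L \<in> sym_convex_bodies"
  shows "(\<lambda>x. (x \<bullet> u) *\<^sub>R u) ` star K L =
    star ((\<lambda>x. (x \<bullet> u) *\<^sub>R u) ` K) ((\<lambda>x. (x \<bullet> u) *\<^sub>R u) ` L)"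
proof -
  have "u \<noteq> 0"
    using assms(1) by auto
  then have "dim (span {u}) = 1"
    by (simp add: dim_span dim_insert)
  then show ?thesis
    using proj_cov dim_ge_2 assms(2,3)
    by (auto simp: projection_covariant_def proj_onto_span[OF assms(1), symmetric])
qed

text \<open>Projecting onto the line of \<open>u\<close> preserves the support function at
  \<open>u\<close>. Covariance moves the projection inside \<open>star\<close>, where each symmetric
  body becomes a segment determined by its support function at \<open>u\<close>.\<close>

lemma support_fun_star_unit:
  assumes u: "norm u = 1" and K: "K \<in> sym_convex_bodies" and L: "L \<in> sym_convex_bodies"
  shows "support_fun (star K L) u = line_fun u (support_fun K u) (support_fun L u)"
proof -
  let ?p = "\<lambda>x. (x \<bullet> u) *\<^sub>R u"
  have uu: "u \<bullet> u = 1"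
    using u by (simp add: norm_eq_1)
  have seg: "?p ` A = symmetric_segment (support_fun A u *\<^sub>R u)" if "A \<in> sym_convex_bodies" for A
  proof (rule convex_body_eqI)
    show "?p ` A \<in> convex_bodies"
      using that by (intro convex_body_linear_image linearI)
        (auto simp: sym_convex_bodies_def inner_add_left scaleR_add_left)
    show "symmetric_segment (support_fun A u *\<^sub>R u) \<in> convex_bodies"
      using symmetric_segment_body by (auto simp: sym_convex_bodies_def)
    fix x
    have A: "compact A" "A \<noteq> {}"
      using that by (auto simp: sym_convex_bodies_def convex_bodies_def)
    have "support_fun (?p ` A) x = support_fun A ((u \<bullet> x) *\<^sub>R u)"
      by (simp add: support_fun_def image_image mult.commute)
    \<comment> \<open>Symmetry of \<open>A\<close> removes the sign, so that positive homogeneity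
      applies.\<close>
    also have "\<dots> = support_fun A (\<bar>u \<bullet> x\<bar> *\<^sub>R u)"
      using support_fun_uminus[OF that, of "(u \<bullet> x) *\<^sub>R u"] by (auto simp: abs_if)
    also have "\<dots> = \<bar>u \<bullet> x\<bar> * support_fun A u"
      by (simp add: support_fun_scaleR A)
    also have "\<dots> = support_fun (symmetric_segment (support_fun A u *\<^sub>R u)) x"
      using support_fun_nonneg[OF that, of u]
      by (simp add: support_fun_symmetric_segment abs_mult)
    finally show "support_fun (?p ` A) x = support_fun (symmetric_segment (support_fun A u *\<^sub>R u)) x" .
  qed
  have "support_fun (star K L) u = support_fun (?p ` star K L) u"
    by (simp add: support_fun_def image_image uu)
  also have "?p ` star K L =
      star (symmetric_segment (support_fun K u *\<^sub>R u)) (symmetric_segment (support_fun L u *\<^sub>R u))"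
    using proj_line[OF u K L] by (simp add: seg K L)
  finally show ?thesis
    by (simp add: line_fun_def)
qed

text \<open>Compute the support function at \<open>v\<close> of the product \<open>A\<close> of two
  segments on the line of \<open>u\<close> in two ways. Covariance puts \<open>A\<close> on that
  line, which yields the factor \<open>u \<bullet> v\<close> outside; projecting the segments onto
  the line of \<open>v\<close> yields it inside both arguments.\<close>

lemma line_fun_change_line:
  assumes u: "norm u = 1" and v: "norm v = 1" and c: "u \<bullet> v \<ge> 0" and st: "s \<ge> 0" "t \<ge> 0"
  shows "line_fun v ((u \<bullet> v) * s) ((u \<bullet> v) * t) = (u \<bullet> v) * line_fun u s t"
proof -
  define A where "A = star (symmetric_segment (s *\<^sub>R u)) (symmetric_segment (t *\<^sub>R u))"
  have A: "compact A" "A \<noteq> {}"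
    using star_body[OF symmetric_segment_body symmetric_segment_body]
    by (auto simp: A_def convex_bodies_def)
  \<comment> \<open>The projection fixes both factors, hence also their product.\<close>
  have "(\<lambda>x. (x \<bullet> u) *\<^sub>R u) ` symmetric_segment (r *\<^sub>R u) = symmetric_segment (r *\<^sub>R u)" for r
    using closed_segment_linear_image[of "\<lambda>x. (x \<bullet> u) *\<^sub>R u" "- (r *\<^sub>R u)" "r *\<^sub>R u"] u
    by (simp add: norm_eq_1 linear_iff inner_add_left scaleR_add_left)
  then have "(\<lambda>x. (x \<bullet> u) *\<^sub>R u) ` A = A"
    using proj_line[OF u symmetric_segment_body symmetric_segment_body] by (simp add: A_def)
  then have "support_fun A v = support_fun ((\<lambda>x. (x \<bullet> u) *\<^sub>R u) ` A) v"
    by simp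
  also have "\<dots> = support_fun A ((u \<bullet> v) *\<^sub>R u)"
    by (simp add: support_fun_def image_image mult.commute)
  also have "\<dots> = (u \<bullet> v) * line_fun u s t"
    by (simp add: support_fun_scaleR A c) (simp add: line_fun_def A_def)
  finally show ?thesis
    using support_fun_star_unit[OF v symmetric_segment_body symmetric_segment_body, of "s *\<^sub>R u" "t *\<^sub>R u"]
      st c by (simp add: A_def support_fun_symmetric_segment abs_mult mult.commute)
qed

text \<open>Changing from an orthogonal line turns the factor \<open>u \<bullet> v\<close> into
  0.\<close>

lemma line_fun_0:
  assumes "norm u = 1"
  shows "line_fun u 0 0 = 0"
proof -
  obtain w where "norm w = 1" "u \<bullet> w = 0"
    using orthogonal_unit_vector_exists[OF dim_ge_2] .
  then show ?thesis
    using line_fun_change_line[of w u 0 0] assms by (simp add: inner_commute)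
qed

lemma line_fun_homogeneous:
  assumes u: "norm u = 1" and st: "s \<ge> 0" "t \<ge> 0" and r: "r \<ge> 0"
  shows "line_fun u (r * s) (r * t) = r * line_fun u s t"
proof -
  text \<open>Moving to a line at angle \<open>\<theta>\<close> with \<open>(cos \<theta>)\<^sup>2 = r\<close> and back scales by \<open>r\<close>.\<close>
  have le1: "line_fun u (r * s) (r * t) = r * line_fun u s t"
    if st: "s \<ge> 0" "t \<ge> 0" and r: "0 \<le> r" "r \<le> 1" for r s t
  proof -
    obtain w where w: "norm w = 1" "u \<bullet> w = 0"
      using orthogonal_unit_vector_exists[OF dim_ge_2] .
    define v where "v = sqrt r *\<^sub>R u + sqrt (1 - r) *\<^sub>R w"
    have uu: "u \<bullet> u = 1" "w \<bullet> w = 1" "w \<bullet> u = 0"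
      using u w by (simp_all add: norm_eq_1 inner_commute)
    have uv: "u \<bullet> v = sqrt r" "v \<bullet> u = sqrt r"
      by (simp_all add: v_def inner_add_right inner_add_left uu w)
    have v: "norm v = 1"
      using r by (simp add: norm_eq_1 v_def inner_add_right inner_add_left uu w)
    have "line_fun u (r * s) (r * t) = line_fun u (sqrt r * (sqrt r * s)) (sqrt r * (sqrt r * t))"
      using r by (simp flip: mult.assoc)
    also have "\<dots> = sqrt r * line_fun v (sqrt r * s) (sqrt r * t)"
      using line_fun_change_line[OF v u, of "sqrt r * s" "sqrt r * t"] r st by (simp add: uv)
    also have "\<dots> = r * line_fun u s t"
      using line_fun_change_line[OF u v, of s t] r st by (simp add: uv flip: mult.assoc)
    finally show ?thesis .
  qed
  show ?thesis
  proof (cases "r \<le> 1")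
    \<comment> \<open>For \<open>r > 1\<close> the case already proved is applied with factor
      \<open>1 / r\<close> to the arguments \<open>r * s\<close> and \<open>r * t\<close>.\<close>
    case False
    then have "line_fun u s t = (1 / r) * line_fun u (r * s) (r * t)"
      using le1[of "r * s" "r * t" "1 / r"] st by simp
    then show ?thesis
      using False by simp
  qed (use le1 st r in auto)
qed

text \<open>At an acute angle, change of line and homogeneity produce the same positive factor on
  both sides, and it cancels. Other pairs are joined by intermediate directions: the normalised sum
  if they are not opposite, an orthogonal vector if they are. The opposite case makes the two ends
  of a product on a line agree.\<close>

lemma line_fun_independent:
  assumes u: "norm u = 1" and v: "norm v = 1" and st: "s \<ge> 0" "t \<ge> 0"
  shows "line_fun u s t = line_fun v s t"
proof -
  have acute: "line_fun u s t = line_fun v s t" if "norm u = 1" "norm v = 1" "u \<bullet> v > 0" for u v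
    using line_fun_change_line[of u v s t] line_fun_homogeneous[of v s t "u \<bullet> v"] that st by simp
  have not_opposite: "line_fun u s t = line_fun v s t"
    if uv: "norm u = 1" "norm v = 1" "u \<noteq> - v" for u v
  proof -
    have uu: "u \<bullet> u = 1" "v \<bullet> v = 1"
      using uv by (simp_all add: norm_eq_1)
    have nz: "u + v \<noteq> 0"
      using uv(3) by (simp add: add_eq_0_iff2)
    then have "(u + v) \<bullet> (u + v) > 0"
      by simp
    then have "1 + u \<bullet> v > 0"
      by (simp add: inner_add_left inner_add_right uu inner_commute)
    \<comment> \<open>Both inner products equal
      \<open>(1 + u \<bullet> v) / norm (u + v)\<close>.\<close>
    then have "u \<bullet> sgn (u + v) > 0" "sgn (u + v) \<bullet> v > 0"
      using nz by (simp_all add: sgn_div_norm inner_add_left inner_add_right uu inner_commute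
          zero_less_divide_iff add.commute)
    then show ?thesis
      using acute[of u "sgn (u + v)"] acute[of "sgn (u + v)" v] uv nz by (simp add: norm_sgn)
  qed
  obtain w where w: "norm w = 1" "u \<bullet> w = 0"
    using orthogonal_unit_vector_exists[OF dim_ge_2] .
  have uu: "u \<bullet> u = 1"
    using u by (simp add: norm_eq_1)
  show ?thesis
  proof (cases "u = - v")
    case True
    have "u \<noteq> - w" "w \<noteq> - v"
      using w uu True by auto
    then show ?thesis
      using not_opposite[of u w] not_opposite[of w v] u v w by simp
  qed (use not_opposite u v in blast)
qed

text \<open>For orthonormal \<open>e\<close> and \<open>e'\<close>, the segments along them have
  support values \<open>s\<close> and \<open>t\<close> at
  \<open>s *\<^sub>R e + t *\<^sub>R e'\<close>, so these two arguments can be prescribed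
  independently. Hence the function of two nonnegative numbers describing \<open>star\<close> is
  itself a restricted support function, that of \<open>M\<close>.\<close>

lemma support_fun_star_eq:
  obtains M and e e' :: "real ^ 'n" where "compact M" "M \<noteq> {}" "norm e = 1" "norm e' = 1"
    "\<And>K L x. K \<in> sym_convex_bodies \<Longrightarrow> L \<in> sym_convex_bodies \<Longrightarrow>
      support_fun (star K L) x = support_fun M (support_fun K x *\<^sub>R e + support_fun L x *\<^sub>R e')"
proof -
  obtain e :: "real ^ 'n" where e: "norm e = 1"
    using vector_choose_size[of 1] by auto
  have eq: "support_fun (star K L) x = line_fun e (support_fun K x) (support_fun L x)"
    if KL: "K \<in> sym_convex_bodies" "L \<in> sym_convex_bodies" for K L x
  proof -
    have bodies: "compact K" "K \<noteq> {}" "compact L" "L \<noteq> {}" "compact (star K L)" "star K L \<noteq> {}"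
      using KL star_body[OF KL] by (auto simp: sym_convex_bodies_def convex_bodies_def)
    show ?thesis
    proof (cases "x = 0")
      case True
      then show ?thesis
        by (simp add: support_fun_0 bodies line_fun_0 e)
    next
      case False
      \<comment> \<open>Homogeneity of support functions and of \<open>line_fun\<close> reduces
        \<open>x\<close> to its direction; independence of the line then replaces \<open>u\<close>
        by the fixed \<open>e\<close>.\<close>
      define u where "u = sgn x"
      have u: "norm u = 1" and x: "x = norm x *\<^sub>R u"
        using False by (simp_all add: u_def norm_sgn sgn_div_norm)
      have nonneg: "support_fun K u \<ge> 0" "support_fun L u \<ge> 0"
        using KL by (simp_all add: support_fun_nonneg)
      have scale: "support_fun A x = norm x * support_fun A u" if "compact A" "A \<noteq> {}" for A
        using support_fun_scaleR[OF that, of "norm x" u] x by simp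
      have "support_fun (star K L) x = norm x * line_fun u (support_fun K u) (support_fun L u)"
        by (simp add: scale bodies support_fun_star_unit u KL)
      also have "\<dots> = norm x * line_fun e (support_fun K u) (support_fun L u)"
        using line_fun_independent[OF u e nonneg] by simp
      also have "\<dots> = line_fun e (support_fun K x) (support_fun L x)"
        by (simp add: scale bodies line_fun_homogeneous e nonneg)
      finally show ?thesis .
    qed
  qed
  obtain e' where e': "norm e' = 1" "e \<bullet> e' = 0"
    using orthogonal_unit_vector_exists[OF dim_ge_2] .
  define M where "M = star (symmetric_segment e) (symmetric_segment e')"
  have M: "compact M" "M \<noteq> {}"
    using star_body[OF symmetric_segment_body symmetric_segment_body]
    by (auto simp: M_def convex_bodies_def)
  have ee: "e \<bullet> e = 1" "e' \<bullet> e' = 1" "e' \<bullet> e = 0"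
    using e e' by (simp_all add: norm_eq_1 inner_commute)
  have "line_fun e s t = support_fun M (s *\<^sub>R e + t *\<^sub>R e')" if "s \<ge> 0" "t \<ge> 0" for s t
    using that by (simp add: M_def eq symmetric_segment_body support_fun_symmetric_segment
        inner_add_right ee e')
  then have "support_fun (star K L) x = support_fun M (support_fun K x *\<^sub>R e + support_fun L x *\<^sub>R e')"
    if "K \<in> sym_convex_bodies" "L \<in> sym_convex_bodies" for K L x
    using that by (simp add: eq support_fun_nonneg)
  then show thesis
    by (rule that[OF M e e'(1)])
qed

text \<open>A linear image has the support function of the original body composed with the adjoint.
  The formula through \<open>M\<close> uses only support values of the two factors, so it commutes
  with this composition.\<close>

lemma GL_covariant: "GL_covariant star"
  unfolding GL_covariant_def
proof (intro ballI allI impI)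
  fix K L :: "(real ^ 'n) set" and \<phi> :: "real ^ 'n \<Rightarrow> real ^ 'n"
  assume KL: "K \<in> sym_convex_bodies" "L \<in> sym_convex_bodies" and lin: "linear \<phi>"
  obtain M and e e' :: "real ^ 'n" where eq: "\<And>K L x. K \<in> sym_convex_bodies \<Longrightarrow> L \<in> sym_convex_bodies \<Longrightarrow>
      support_fun (star K L) x = support_fun M (support_fun K x *\<^sub>R e + support_fun L x *\<^sub>R e')"
    by (rule support_fun_star_eq) metis
  have img: "support_fun (\<phi> ` A) x = support_fun A (adjoint \<phi> x)" for A x
    by (simp add: support_fun_def image_image adjoint_works[OF lin, symmetric])
  show "\<phi> ` star K L = star (\<phi> ` K) (\<phi> ` L)"
    by (rule convex_body_eqI)
       (simp_all add: img eq KL star_body convex_body_linear_image sym_convex_body_linear_image lin)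
qed

lemma continuous: "hausdorff_continuous star"
  unfolding hausdorff_continuous_def
proof (intro allI impI)
  fix Ks Ls :: "nat \<Rightarrow> (real ^ 'n) set" and K L
  assume bodies: "\<forall>m. Ks m \<in> sym_convex_bodies" "\<forall>m. Ls m \<in> sym_convex_bodies"
      "K \<in> sym_convex_bodies" "L \<in> sym_convex_bodies"
    and lim: "hausdorff_conv Ks K" "hausdorff_conv Ls L"
  obtain M and e e' :: "real ^ 'n" where M: "compact M" "M \<noteq> {}" and e: "norm e = 1" "norm e' = 1"
    and eq: "\<And>K L x. K \<in> sym_convex_bodies \<Longrightarrow> L \<in> sym_convex_bodies \<Longrightarrow>
      support_fun (star K L) x = support_fun M (support_fun K x *\<^sub>R e + support_fun L x *\<^sub>R e')"
    by (rule support_fun_star_eq) metis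
  obtain C where C: "C > 0" "\<And>y. y \<in> M \<Longrightarrow> norm y \<le> C"
    using compact_imp_bounded[OF M(1)] bounded_pos by metis
  have sym: "A \<in> convex_bodies" if "A \<in> sym_convex_bodies" for A :: "(real ^ 'n) set"
    using that by (simp add: sym_convex_bodies_def)
  have nonneg: "hausdorff_dist A B \<ge> 0" if "A \<in> convex_bodies" for A B :: "(real ^ 'n) set"
    using that by (auto simp: convex_bodies_def intro: hausdorff_dist_nonneg)
  \<comment> \<open>\<open>C\<close> is the Lipschitz constant of the support function of
    \<open>M\<close>; as \<open>e\<close> and \<open>e'\<close> are unit vectors, changes
    \<open>a\<close> and \<open>b\<close> of the support values move its argument by at most
    \<open>\<bar>a\<bar> + \<bar>b\<bar>\<close>.\<close>
  let ?d = "\<lambda>m. C * (hausdorff_dist (Ks m) K + hausdorff_dist (Ls m) L)"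
  have le: "hausdorff_dist (star (Ks m) (Ls m)) (star K L) \<le> ?d m" for m
  proof (rule hausdorff_dist_le_support_fun_diff)
    show "star (Ks m) (Ls m) \<in> convex_bodies" "star K L \<in> convex_bodies"
      using bodies by (simp_all add: star_body)
    show "0 \<le> ?d m"
      using C(1) bodies by (intro mult_nonneg_nonneg add_nonneg_nonneg nonneg sym) auto
    fix u :: "real ^ 'n"
    assume u: "norm u = 1"
    define a where "a = support_fun (Ks m) u - support_fun K u"
    define b where "b = support_fun (Ls m) u - support_fun L u"
    have "\<bar>support_fun (star (Ks m) (Ls m)) u - support_fun (star K L) u\<bar>
        \<le> C * norm ((support_fun (Ks m) u *\<^sub>R e + support_fun (Ls m) u *\<^sub>R e') -
            (support_fun K u *\<^sub>R e + support_fun L u *\<^sub>R e'))"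
      unfolding eq[OF bodies(1,2)[rule_format]] eq[OF bodies(3,4)]
      by (rule support_fun_diff_le[OF M C(2)])
    also have "\<dots> = C * norm (a *\<^sub>R e + b *\<^sub>R e')"
      by (simp add: a_def b_def algebra_simps)
    also have "norm (a *\<^sub>R e + b *\<^sub>R e') \<le> \<bar>a\<bar> + \<bar>b\<bar>"
      using norm_triangle_ineq[of "a *\<^sub>R e" "b *\<^sub>R e'"] e by simp
    also have "\<dots> \<le> hausdorff_dist (Ks m) K + hausdorff_dist (Ls m) L"
      unfolding a_def b_def using bodies
      by (intro add_mono support_fun_diff_le_hausdorff_dist sym u) auto
    finally show "\<bar>support_fun (star (Ks m) (Ls m)) u - support_fun (star K L) u\<bar> \<le> ?d m"
      using C(1) by simp
  qed
  have "?d \<longlonglongrightarrow> C * (0 + 0)"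
    using lim unfolding hausdorff_conv_def by (intro tendsto_intros)
  then have "?d \<longlonglongrightarrow> 0"
    by simp
  then show "hausdorff_conv (\<lambda>m. star (Ks m) (Ls m)) (star K L)"
    unfolding hausdorff_conv_def
  proof (rule Lim_null_comparison[OF always_eventually, rotated], intro allI)
    fix m
    have "0 \<le> hausdorff_dist (star (Ks m) (Ls m)) (star K L)"
      using bodies by (intro nonneg star_body) auto
    then show "norm (hausdorff_dist (star (Ks m) (Ls m)) (star K L)) \<le> ?d m"
      using le[of m] by simp
  qed
qed

end

theorem corollary7p7:
  fixes star :: "(real ^ 'n) set \<Rightarrow> (real ^ 'n) set \<Rightarrow> (real ^ 'n) set"
  assumes "CARD('n) \<ge> 2"
    and "\<And>K L. K \<in> sym_convex_bodies \<Longrightarrow> L \<in> sym_convex_bodies \<Longrightarrow> star K L \<in> convex_bodies"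
  shows "(projection_covariant star \<longleftrightarrow> hausdorff_continuous star \<and> GL_covariant star) \<and>
         (hausdorff_continuous star \<and> GL_covariant star \<longrightarrow> homogeneous_deg_1 star)"
proof -
  have "hausdorff_continuous star \<and> GL_covariant star" if "projection_covariant star"
  proof -
    interpret projection_covariant_operation star
      using assms that by unfold_locales
    show ?thesis
      using continuous GL_covariant by blast
  qed
  moreover have "projection_covariant star \<and> homogeneous_deg_1 star"
    if "hausdorff_continuous star" "GL_covariant star"
    using projection_covariant_if_continuous_GL_covariant[where star = star, OF _ that]
      homogeneous_if_continuous_GL_covariant[where star = star, OF _ that] assms(2) by simp
  ultimately show ?thesis
    by blast
qed

end
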